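(* Let $R$ be a $2$-primal, local and strongly nil-clean ring. Then the $2\times 2$ matrix ring $\mathrm{M}_2(R)$ is a GSNC ring.
   Context: Rings are associative with identity, not necessarily commutative. $R$ is $2$-primal if its set of nilpotent elements $\mathrm{Nil}(R)$ equals its prime radical (lower nilradical) $\mathrm{Nil}_*(R)$. $R$ is local if $R/J(R)$ is a division ring, where $J(R)$ is the Jacobson radical. An element $a$ of a ring is strongly nil-clean if $a=e+q$ with $e$ idempotent, $q$ nilpotent and $eq=qe$. A ring is strongly nil-clean if every element is strongly nil-clean, and generalized strongly nil-clean (GSNC) if every non-invertible element is strongly nil-clean. *)

theory Defs
  imports "HOL-Algebra.QuotRing" "HOL-Algebra.Ideal_Product"
begin

text \<open>
  All notions are for associative unital rings, i.e. for the locale \<^locale>\<open>ring\<close>. The library's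
  \<^locale>\<open>primeideal\<close>, \<^locale>\<open>domain\<close> and \<^locale>\<open>field\<close> assume commutativity, hence the
  noncommutative counterparts below.
\<close>

definition nilpotents :: "('a, 'm) ring_scheme \<Rightarrow> 'a set"
  where "nilpotents R = {a \<in> carrier R. \<exists>n::nat. a [^]\<^bsub>R\<^esub> n = \<zero>\<^bsub>R\<^esub>}"

definition idempotents :: "('a, 'm) ring_scheme \<Rightarrow> 'a set"
  where "idempotents R = {e \<in> carrier R. e \<otimes>\<^bsub>R\<^esub> e = e}"

locale nc_primeideal = ideal P R for P and R (structure) +
  assumes proper: "P \<noteq> carrier R"
    and prime: "\<lbrakk>ideal I R; ideal J R; I \<cdot> J \<subseteq> P\<rbrakk> \<Longrightarrow> I \<subseteq> P \<or> J \<subseteq> P"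

text \<open>
  The intersections with the carrier below only matter for the zero ring, which has no proper ideals.
\<close>

definition prime_radical :: "('a, 'm) ring_scheme \<Rightarrow> 'a set"
  where "prime_radical R = carrier R \<inter> \<Inter>{P. nc_primeideal P R}"

locale left_ideal = additive_subgroup I R + ring R for I and R (structure) +
  assumes l_closed: "\<lbrakk>a \<in> I; x \<in> carrier R\<rbrakk> \<Longrightarrow> x \<otimes> a \<in> I"

locale maximal_left_ideal = left_ideal I R for I and R (structure) +
  assumes proper: "I \<noteq> carrier R"
    and maximal: "\<lbrakk>left_ideal J R; I \<subseteq> J\<rbrakk> \<Longrightarrow> J = I \<or> J = carrier R"

definition jacobson_radical :: "('a, 'm) ring_scheme \<Rightarrow> 'a set"
  where "jacobson_radical R = carrier R \<inter> \<Inter>{I. maximal_left_ideal I R}"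

locale two_primal_ring = ring R for R (structure) +
  assumes nilpotents_eq: "nilpotents R = prime_radical R"

locale division_ring = ring R for R (structure) +
  assumes one_neq_zero: "\<one> \<noteq> \<zero>"
    and nonzero_Units: "a \<in> carrier R - {\<zero>} \<Longrightarrow> a \<in> Units R"

locale local_ring = ring R for R (structure) +
  assumes division_ring_quot: "division_ring (R Quot jacobson_radical R)"

definition strongly_nil_clean :: "('a, 'm) ring_scheme \<Rightarrow> 'a \<Rightarrow> bool"
  where "strongly_nil_clean R a \<longleftrightarrow>
    (\<exists>e \<in> idempotents R. \<exists>q \<in> nilpotents R. a = e \<oplus>\<^bsub>R\<^esub> q \<and> e \<otimes>\<^bsub>R\<^esub> q = q \<otimes>\<^bsub>R\<^esub> e)"

locale strongly_nil_clean_ring = ring R for R (structure) +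
  assumes all_strongly_nil_clean: "a \<in> carrier R \<Longrightarrow> strongly_nil_clean R a"

locale gsnc_ring = ring R for R (structure) +
  assumes non_Units_strongly_nil_clean:
    "\<lbrakk>a \<in> carrier R; a \<notin> Units R\<rbrakk> \<Longrightarrow> strongly_nil_clean R a"

text \<open>
  The ring of \<open>n \<times> n\<close> matrices over \<open>R\<close>. A matrix is a map from index pairs \<open>(i, j)\<close> with
  \<open>i, j < n\<close> to the carrier of \<open>R\<close>; it is extensional (\<^const>\<open>undefined\<close> on all other pairs), so
  that matrices with equal entries are equal.
\<close>

definition mat_ring :: "nat \<Rightarrow> ('a, 'm) ring_scheme \<Rightarrow> (nat \<times> nat \<Rightarrow> 'a) ring"
  where "mat_ring n R =
    \<lparr>carrier = ({..<n} \<times> {..<n}) \<rightarrow>\<^sub>E carrier R,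
     mult = (\<lambda>A B. \<lambda>(i, j) \<in> {..<n} \<times> {..<n}. \<Oplus>\<^bsub>R\<^esub>k \<in> {..<n}. A (i, k) \<otimes>\<^bsub>R\<^esub> B (k, j)),
     one = (\<lambda>(i, j) \<in> {..<n} \<times> {..<n}. if i = j then \<one>\<^bsub>R\<^esub> else \<zero>\<^bsub>R\<^esub>),
     zero = (\<lambda>p \<in> {..<n} \<times> {..<n}. \<zero>\<^bsub>R\<^esub>),
     add = (\<lambda>A B. \<lambda>p \<in> {..<n} \<times> {..<n}. A p \<oplus>\<^bsub>R\<^esub> B p)\<rparr>"

end

theory Submission
  imports Defs "HOL-Algebra.Subrings" "HOL-Algebra.Ring_Divisibility"
begin

text \<open>
  A local ring has only the trivial idempotents, so every element of \<open>R\<close> is congruent to \<open>0\<close> or \<open>1\<close>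
  modulo the ideal \<open>N\<close> of nilpotent elements, that is, \<open>R / N\<close> is the field with two elements.
  Since \<open>N\<close> is the prime radical, the ideal \<open>M\<^sub>2(N)\<close> of the matrix ring is nil. By
  Cayley--Hamilton modulo \<open>N\<close>, each matrix \<open>A\<close> satisfies \<open>A B \<equiv> 0\<close> or \<open>A B \<equiv> 1\<close> where
  \<open>B = A\<close> or \<open>B = 1 - A\<close>. If \<open>A B \<equiv> 1\<close>, then \<open>A\<close> is a unit. Otherwise \<open>A B\<close> is nilpotent, so
  either \<open>A\<close> is nilpotent or the idempotent \<open>A\<close> lifts modulo nilpotents to one commuting with \<open>A\<close>.
\<close>

section \<open>Units, nilpotent elements and lifting of idempotents\<close>

context ring
begin

lemma minus_add_cancel: "x \<in> carrier R \<Longrightarrow> y \<in> carrier R \<Longrightarrow> y \<ominus> x \<oplus> x = y"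
  by algebra

lemma add_minus_cancel: "x \<in> carrier R \<Longrightarrow> y \<in> carrier R \<Longrightarrow> x \<oplus> (y \<ominus> x) = y"
  by algebra

lemma commute_if_add_eq_one:
  assumes "a \<in> carrier R" "b \<in> carrier R" "a \<oplus> b = \<one>"
  shows "a \<otimes> b = b \<otimes> a"
proof -
  have "a \<otimes> (a \<oplus> b) = (a \<oplus> b) \<otimes> a"
    using assms by simp
  then show ?thesis
    using assms(1,2) by (simp add: r_distr l_distr)
qed

text \<open>The witness \<open>c\<close> is the geometric sum \<open>1 + a + ... + a^(n-1)\<close>,
  built by passing from \<open>c\<close> to \<open>c a + 1\<close> and starting from
  \<open>0\<close> at exponent \<open>0\<close>. Writing \<open>a + b = 1\<close> instead of
  \<open>b = 1 - a\<close> lets either element take either role.\<close>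

lemma one_minus_pow_dvd:
  assumes "a \<in> carrier R" "b \<in> carrier R" "a \<oplus> b = \<one>"
  shows "\<exists>c \<in> carrier R. c \<otimes> b = b \<otimes> c \<and> a [^] (n::nat) \<oplus> b \<otimes> c = \<one>"
proof (induction n)
  case 0
  show ?case
    using assms by (intro bexI[of _ \<zero>]) auto
next
  case (Suc n)
  then obtain c where c: "c \<in> carrier R" "c \<otimes> b = b \<otimes> c" "a [^] n \<oplus> b \<otimes> c = \<one>"
    by blast
  have ab: "a \<otimes> b = b \<otimes> a"
    by (rule commute_if_add_eq_one[OF assms])
  show ?case
  proof (intro bexI conjI)
    have "(c \<otimes> a \<oplus> \<one>) \<otimes> b = c \<otimes> (a \<otimes> b) \<oplus> b"
      using assms c(1) by (simp add: l_distr m_assoc)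
    also have "\<dots> = b \<otimes> (c \<otimes> a \<oplus> \<one>)"
      unfolding ab using assms c(1) by (simp add: r_distr m_assoc[symmetric] c(2))
    finally show "(c \<otimes> a \<oplus> \<one>) \<otimes> b = b \<otimes> (c \<otimes> a \<oplus> \<one>)" .
    have "a [^] Suc n \<oplus> b \<otimes> (c \<otimes> a \<oplus> \<one>) = (a [^] n \<oplus> b \<otimes> c) \<otimes> a \<oplus> b"
      using assms c(1) by (simp add: l_distr r_distr m_assoc a_assoc)
    then show "a [^] Suc n \<oplus> b \<otimes> (c \<otimes> a \<oplus> \<one>) = \<one>"
      using assms c by simp
  qed (use assms c in simp)
qed

text \<open>If \<open>a^n = 0\<close>, the geometric series terminates: its sum \<open>c\<close>
  satisfies \<open>b c = 1\<close> and commutes with \<open>b\<close>.\<close>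

lemma Units_if_one_minus_nilpotent:
  assumes "a \<in> nilpotents R" "b \<in> carrier R" "a \<oplus> b = \<one>"
  shows "b \<in> Units R"
proof -
  obtain n :: nat where a: "a \<in> carrier R" "a [^] n = \<zero>"
    using assms(1) by (auto simp: nilpotents_def)
  obtain c where c: "c \<in> carrier R" "c \<otimes> b = b \<otimes> c" "a [^] n \<oplus> b \<otimes> c = \<one>"
    using one_minus_pow_dvd[OF a(1) assms(2,3)] by blast
  then have "b \<otimes> c = \<one>"
    using a assms by simp
  then show ?thesis
    using c assms by (auto simp: Units_def)
qed

text \<open>With \<open>c\<close> the inverse of \<open>a b\<close>, the element \<open>b c\<close>
  is a right inverse of \<open>a\<close> and, by commutation, \<open>c b\<close> is a left inverse;
  hence the two coincide.\<close>

lemma Units_if_commuting_mult_Units: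
  assumes "a \<in> carrier R" "b \<in> carrier R" "a \<otimes> b = b \<otimes> a" "a \<otimes> b \<in> Units R"
  shows "a \<in> Units R"
proof -
  let ?c = "inv (a \<otimes> b)"
  have c: "?c \<in> carrier R"
    using assms(4) by simp
  have r: "a \<otimes> (b \<otimes> ?c) = \<one>"
    using assms c by (simp add: m_assoc[symmetric])
  have l: "(?c \<otimes> b) \<otimes> a = \<one>"
    using assms(1-3) c Units_l_inv[OF assms(4)] by (simp add: m_assoc)
  have "?c \<otimes> b = b \<otimes> ?c"
    by (rule inv_unique[OF l r]) (use assms c in simp_all)
  then have "(b \<otimes> ?c) \<otimes> a = \<one>"
    using l by simp
  then show ?thesis
    unfolding Units_def using assms(1,2) c r by blast
qed

lemma nilpotents_if_square_nilpotent:
  assumes "a \<in> carrier R" "a \<otimes> a \<in> nilpotents R"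
  shows "a \<in> nilpotents R"
proof -
  obtain n :: nat where "(a \<otimes> a) [^] n = \<zero>"
    using assms(2) by (auto simp: nilpotents_def)
  moreover have "a \<otimes> a = a [^] (2::nat)"
    using assms(1) by (metis nat_pow_mult nat_pow_eone one_add_one)
  ultimately have "a [^] (2 * n) = \<zero>"
    using assms(1) by (simp add: nat_pow_pow)
  then show ?thesis
    using assms(1) by (auto simp: nilpotents_def)
qed

end

text \<open>With \<open>x = a\<^sup>n\<close> and \<open>1 - x = (1 - a) c\<close>, the idempotent is \<open>u = 1 - (1 - x)\<^sup>n\<close>: it is
  divisible by \<open>a\<^sup>n\<close>, and \<open>1 - u\<close> is divisible by \<open>(1 - a)\<^sup>n\<close>.\<close>
lemma (in cring) idempotent_lift:
  assumes a: "a \<in> carrier R" and b: "b \<in> carrier R" and ab: "a \<oplus> b = \<one>"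
    and nil: "(a \<otimes> b) [^] (k::nat) = \<zero>"
  shows "\<exists>u \<in> carrier R. \<exists>q \<in> carrier R. u \<otimes> u = u \<and> (\<exists>m::nat. q [^] m = \<zero>) \<and> a = u \<oplus> q"
proof -
  \<comment> \<open>A positive exponent allows \<open>a^n = A a\<close> and
    \<open>b^n = B b\<close>, so that \<open>a b\<close> can be factored out of \<open>q\<close>
    below.\<close>
  define n where "n = Suc k"
  have nil: "(a \<otimes> b) [^] n = \<zero>"
    using nil a b by (simp add: n_def)
  obtain c where c: "c \<in> carrier R" and xc: "a [^] n \<oplus> b \<otimes> c = \<one>"
    using one_minus_pow_dvd[OF a b ab, of n] by blast
  \<comment> \<open>The summands \<open>a^n\<close> and \<open>b c\<close> again add up to one, so
    the same lemma applies to \<open>b c\<close>. Below, \<open>u\<close> is \<open>a^n d\<close>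
    and \<open>v\<close> is \<open>(b c)^n\<close>, with \<open>u + v = 1\<close>.\<close>
  obtain d where d: "d \<in> carrier R" and yd: "(b \<otimes> c) [^] n \<oplus> a [^] n \<otimes> d = \<one>"
    using one_minus_pow_dvd[of "b \<otimes> c" "a [^] n" n] a b c xc by (auto simp: a_comm)
  define A B where "A = a [^] k" and "B = b [^] k"
  have A: "A \<in> carrier R" and B: "B \<in> carrier R"
    using a b by (auto simp: A_def B_def)
  define C where "C = c [^] n"
  have C: "C \<in> carrier R"
    using c by (simp add: C_def)
  define u v where "u = A \<otimes> a \<otimes> d" and "v = B \<otimes> b \<otimes> C"
  have u: "u \<in> carrier R" and v: "v \<in> carrier R"
    using a b d A B C by (auto simp: u_def v_def)
  have uv1: "u \<oplus> v = \<one>"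
    using yd a b c d by (simp add: u_def v_def A_def B_def C_def n_def nat_pow_distrib a_comm m_ac)
  have "u \<otimes> v = (a \<otimes> b) [^] n \<otimes> (d \<otimes> C)"
    using a b d A B C unfolding u_def v_def n_def
    by (simp add: nat_pow_distrib A_def[symmetric] B_def[symmetric] m_ac)
  then have uv0: "u \<otimes> v = \<zero>"
    using nil d C by simp
  have "u \<otimes> u = u \<otimes> (u \<oplus> v)"
    using uv0 u v by (simp add: r_distr)
  then have uu: "u \<otimes> u = u"
    using uv1 u by simp
  \<comment> \<open>This is \<open>a - u\<close>: since \<open>a + b\<close> and
    \<open>u + v\<close> are both one, \<open>a - u = a (u + v) - (a + b) u = a v - b u\<close>, and
    both terms contain the factor \<open>a b\<close>.\<close>
  define q where "q = (a \<otimes> b) \<otimes> (B \<otimes> C \<ominus> A \<otimes> d)"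
  have q: "q \<in> carrier R"
    using a b d A B C by (simp add: q_def)
  have "q [^] n = (a \<otimes> b) [^] n \<otimes> (B \<otimes> C \<ominus> A \<otimes> d) [^] n"
    unfolding q_def using a b d A B C by (intro nat_pow_distrib) auto
  then have qn: "q [^] n = \<zero>"
    using nil a b d A B C by simp
  have "q \<oplus> (a \<oplus> b) \<otimes> u = a \<otimes> (u \<oplus> v)"
    unfolding q_def u_def v_def using a b d A B C by algebra
  then have "a = u \<oplus> q"
    using ab uv1 a u q by (simp add: a_comm)
  then show ?thesis
    using u q uu qn by blast
qed

text \<open>The double centralizer of \<open>a\<close> is commutative: each of its elements commutes
  with \<open>a\<close>, hence lies in the centralizer, with which every other element of
  \<open>C\<close> commutes. It allows commutative arguments about a single element of a
  noncommutative ring.\<close>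

lemma (in ring) bicommutant_subcring:
  assumes a: "a \<in> carrier R"
  defines "C \<equiv> {x \<in> carrier R. \<forall>y \<in> carrier R. y \<otimes> a = a \<otimes> y \<longrightarrow> x \<otimes> y = y \<otimes> x}"
  shows "subcring C R"
proof (intro subcringI subringI)
  fix x y assume xy: "x \<in> C" "y \<in> C"
  have "y \<otimes> a = a \<otimes> y"
    using a xy(2) by (simp add: C_def)
  then show "x \<otimes> y = y \<otimes> x"
    using xy by (simp add: C_def)
  have "x \<otimes> y \<otimes> z = z \<otimes> (x \<otimes> y)" if z: "z \<in> carrier R" "z \<otimes> a = a \<otimes> z" for z
  proof -
    have carr: "x \<in> carrier R" "y \<in> carrier R" and "x \<otimes> z = z \<otimes> x" "y \<otimes> z = z \<otimes> y"
      using xy z by (simp_all add: C_def)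
    then show ?thesis
      using z(1) by (metis m_assoc)
  qed
  then show "x \<otimes> y \<in> C"
    using xy by (simp add: C_def)
  show "x \<oplus> y \<in> C"
    using xy by (auto simp: C_def l_distr r_distr)
qed (auto simp: C_def l_minus r_minus)

text \<open>The commutative lifting lemma is applied inside the double centralizer of
  \<open>a\<close>, which contains \<open>a\<close> and \<open>b = 1 - a\<close>. The idempotent and
  the nilpotent part found there commute automatically.\<close>

lemma (in ring) strongly_nil_clean_if_nilpotent_mult_one_minus:
  assumes a: "a \<in> carrier R" and b: "b \<in> carrier R" and ab: "a \<oplus> b = \<one>"
    and nil: "a \<otimes> b \<in> nilpotents R"
  shows "strongly_nil_clean R a"
proof -
  define C where "C = {x \<in> carrier R. \<forall>y \<in> carrier R. y \<otimes> a = a \<otimes> y \<longrightarrow> x \<otimes> y = y \<otimes> x}"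
  have sub: "C \<subseteq> carrier R"
    by (auto simp: C_def)
  have "subcring C R"
    unfolding C_def by (rule bicommutant_subcring[OF a])
  then interpret C: cring "R\<lparr>carrier := C\<rparr>"
    using subcring_iff[OF sub] by simp
  have aC: "a \<in> C"
    using a by (auto simp: C_def)
  have "b = \<one> \<ominus> a"
    using a b ab[symmetric] by algebra
  then have bC: "b \<in> C"
    using subcringE[OF \<open>subcring C R\<close>] aC by (simp add: a_minus_def)
  obtain k :: nat where "(a \<otimes> b) [^] k = \<zero>"
    using nil by (auto simp: nilpotents_def)
  then obtain u q and m :: nat where "u \<in> C" "q \<in> C" "u \<otimes> u = u" "q [^] m = \<zero>" "a = u \<oplus> q"
    using C.idempotent_lift[of a b k] aC bC ab by (auto simp: nat_pow_consistent[symmetric])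
  moreover have "u \<otimes> q = q \<otimes> u"
    using C.m_comm[of u q] \<open>u \<in> C\<close> \<open>q \<in> C\<close> by simp
  ultimately show ?thesis
    using sub by (auto simp: strongly_nil_clean_def idempotents_def nilpotents_def)
qed

lemma (in ring) strongly_nil_clean_if_nilpotent:
  assumes "a \<in> nilpotents R"
  shows "strongly_nil_clean R a"
  using assms unfolding strongly_nil_clean_def
  by (intro bexI[of _ \<zero>] bexI[of _ a]) (auto simp: idempotents_def nilpotents_def)

section \<open>Left ideals, the Jacobson radical and idempotents of local rings\<close>

lemma (in ring) left_idealI:
  assumes "I \<subseteq> carrier R" "\<zero> \<in> I" "\<And>x y. x \<in> I \<Longrightarrow> y \<in> I \<Longrightarrow> x \<oplus> y \<in> I"
    and "\<And>x r. x \<in> I \<Longrightarrow> r \<in> carrier R \<Longrightarrow> r \<otimes> x \<in> I"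
  shows "left_ideal I R"
proof (intro left_ideal.intro left_ideal_axioms.intro additive_subgroup.intro)
  have "\<ominus> x \<in> I" if "x \<in> I" for x
    using assms(4)[OF that, of "\<ominus> \<one>"] assms(1) that by (auto simp: l_minus)
  then show "subgroup I (add_monoid R)"
    using assms by (intro add.subgroupI) auto
qed (use assms ring_axioms in auto)

text \<open>Zorn's lemma is applied to the left ideals that contain \<open>I\<close> and avoid one.
  A left ideal containing one is the whole ring, so a maximal member of this family is maximal among
  all proper left ideals.\<close>

lemma (in ring) exists_maximal_left_ideal:
  assumes I: "left_ideal I R" and "\<one> \<notin> I"
  shows "\<exists>M. maximal_left_ideal M R \<and> I \<subseteq> M"
proof -
  define S where "S = {K. left_ideal K R \<and> I \<subseteq> K \<and> \<one> \<notin> K}"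
  have "\<exists>M\<in>S. \<forall>X\<in>S. M \<subseteq> X \<longrightarrow> X = M"
  proof (rule subset_Zorn_nonempty)
    fix \<C> assume ne: "\<C> \<noteq> {}" and ch: "subset.chain S \<C>"
    have left: "left_ideal K R" if "K \<in> \<C>" for K
      using that ch by (auto simp: subset.chain_def S_def)
    have "left_ideal (\<Union>\<C>) R"
    proof (rule left_idealI)
      show "\<Union>\<C> \<subseteq> carrier R"
        using left_ideal.axioms(1)[OF left, THEN additive_subgroup.a_subset] by (rule Union_least)
      obtain K where "K \<in> \<C>"
        using ne by blast
      then have "\<zero> \<in> K"
        using left_ideal.axioms(1)[OF left, THEN additive_subgroup.zero_closed] by simp
      then show "\<zero> \<in> \<Union>\<C>"
        using \<open>K \<in> \<C>\<close> by (rule UnionI[rotated])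
    next
      fix x y assume "x \<in> \<Union>\<C>" "y \<in> \<Union>\<C>"
      \<comment> \<open>In a chain, finitely many elements of the union already lie in a single
        member.\<close>
      then obtain K where K: "K \<in> \<C>" "{x, y} \<subseteq> K"
        using finite_subset_Union_chain[of "{x, y}" \<C> S] ne ch by auto
      then have "x \<oplus> y \<in> K"
        using left_ideal.axioms(1)[OF left, THEN additive_subgroup.a_closed] by simp
      then show "x \<oplus> y \<in> \<Union>\<C>"
        using K(1) by (rule UnionI[rotated])
    next
      fix x r assume "x \<in> \<Union>\<C>" and r: "r \<in> carrier R"
      then obtain K where K: "K \<in> \<C>" "x \<in> K"
        by blast
      then have "r \<otimes> x \<in> K"
        using left_ideal.l_closed[OF left] r by simp
      then show "r \<otimes> x \<in> \<Union>\<C>"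
        using K(1) by (rule UnionI[rotated])
    qed
    then show "\<Union>\<C> \<in> S"
      using ne ch by (auto simp: S_def subset.chain_def)
  qed (use assms in \<open>auto simp: S_def\<close>)
  then obtain M where M: "left_ideal M R" "I \<subseteq> M" "\<one> \<notin> M"
    and max: "\<And>K. K \<in> S \<Longrightarrow> M \<subseteq> K \<Longrightarrow> K = M"
    by (auto simp: S_def)
  have "K = M \<or> K = carrier R" if K: "left_ideal K R" "M \<subseteq> K" for K
  proof (cases "\<one> \<in> K")
    case True
    then have "x \<in> K" if "x \<in> carrier R" for x
      using left_ideal.l_closed[OF K(1) True that] that by simp
    then show ?thesis
      using additive_subgroup.a_subset[OF left_ideal.axioms(1)[OF K(1)]] by blast
  next
    case False
    then show ?thesis
      using K M(2) max[of K] by (auto simp: S_def)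
  qed
  then have "maximal_left_ideal M R"
    using M by (intro maximal_left_ideal.intro maximal_left_ideal_axioms.intro) auto
  then show ?thesis
    using M(2) by blast
qed

lemma (in ring) left_ideal_jacobson_radical: "left_ideal (jacobson_radical R) R"
proof -
  have left: "left_ideal M R" if "maximal_left_ideal M R" for M
    using that by (rule maximal_left_ideal.axioms)
  note facts = left_ideal.l_closed[OF left] left_ideal.axioms(1)[OF left, THEN additive_subgroup.a_closed]
    left_ideal.axioms(1)[OF left, THEN additive_subgroup.zero_closed]
  show ?thesis
    by (rule left_idealI) (simp_all add: jacobson_radical_def facts)
qed

text \<open>Let \<open>f = 1 - e\<close>. If \<open>1 = x f\<close>, then
  \<open>e = x f e = 0\<close>; so for nonzero \<open>e\<close> the left ideal \<open>R f\<close> is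
  proper and lies in some maximal left ideal \<open>M\<close>. But \<open>e\<close> is in
  \<open>M\<close> as well, so \<open>M\<close> contains \<open>e + f = 1\<close>.\<close>

lemma (in ring) idempotent_in_jacobson_radical:
  assumes e: "e \<in> idempotents R" and J: "e \<in> jacobson_radical R"
  shows "e = \<zero>"
proof (rule ccontr)
  assume "e \<noteq> \<zero>"
  have ec: "e \<in> carrier R" and ee: "e \<otimes> e = e"
    using e by (auto simp: idempotents_def)
  define f where "f = \<one> \<ominus> e"
  have fc: "f \<in> carrier R" and fe: "f \<otimes> e = \<zero>" and ef: "e \<oplus> f = \<one>"
    unfolding f_def using ec by (simp, simp add: a_minus_def l_distr l_minus ee r_neg, algebra)
  have "left_ideal ((\<lambda>x. x \<otimes> f) ` carrier R) R"
  proof (rule left_idealI)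
    show "\<zero> \<in> (\<lambda>x. x \<otimes> f) ` carrier R"
      using fc by (intro image_eqI[of _ _ \<zero>]) auto
    fix x y assume "x \<in> (\<lambda>x. x \<otimes> f) ` carrier R" "y \<in> (\<lambda>x. x \<otimes> f) ` carrier R"
    then show "x \<oplus> y \<in> (\<lambda>x. x \<otimes> f) ` carrier R"
      using fc by (auto simp: l_distr[symmetric])
  next
    fix x r assume "x \<in> (\<lambda>x. x \<otimes> f) ` carrier R" "r \<in> carrier R"
    then show "r \<otimes> x \<in> (\<lambda>x. x \<otimes> f) ` carrier R"
      using fc by (auto simp: m_assoc[symmetric])
  qed (use fc in auto)
  moreover have "\<one> \<notin> (\<lambda>x. x \<otimes> f) ` carrier R"
  proof
    assume "\<one> \<in> (\<lambda>x. x \<otimes> f) ` carrier R"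
    then obtain x where x: "x \<in> carrier R" "\<one> = x \<otimes> f"
      by auto
    have "e = x \<otimes> f \<otimes> e"
      using ec by (simp flip: x(2))
    then show False
      using x(1) fc ec fe \<open>e \<noteq> \<zero>\<close> by (simp add: m_assoc)
  qed
  ultimately obtain M where M: "maximal_left_ideal M R" "(\<lambda>x. x \<otimes> f) ` carrier R \<subseteq> M"
    using exists_maximal_left_ideal by blast
  interpret M: maximal_left_ideal M R
    by (rule M)
  have "\<one> \<otimes> f \<in> M"
    using M(2) by blast
  then have "f \<in> M"
    using fc by simp
  moreover have "e \<in> M"
    using J M(1) by (simp add: jacobson_radical_def)
  ultimately have "\<one> \<in> M"
    using M.a_closed[of e f] ef by simp
  then have "M = carrier R"
    using M.l_closed[of \<one>] M.a_subset by force
  then show False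
    using M.proper by simp
qed

text \<open>If one were zero, its coset would be the radical itself, the zero of the quotient,
  contradicting nontriviality of a division ring.\<close>

lemma (in local_ring) one_neq_zero: "\<one> \<noteq> \<zero>"
proof
  assume "\<one> = \<zero>"
  interpret J: left_ideal "jacobson_radical R" R
    by (rule left_ideal_jacobson_radical)
  have "jacobson_radical R +> \<one> = jacobson_radical R"
    using J.a_subset by (auto simp: \<open>\<one> = \<zero>\<close> a_r_coset_def' subset_eq)
  then show False
    using division_ring.one_neq_zero[OF division_ring_quot] by (simp add: FactRing_simps)
qed

text \<open>Modulo the radical, \<open>e\<close> is zero or a unit. In the first case
  \<open>e\<close> lies in the radical and vanishes. In the second, \<open>e b = j + 1\<close> with
  \<open>j\<close> in the radical; left multiplication by \<open>f = 1 - e\<close> gives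
  \<open>0 = f j + f\<close>, so the idempotent \<open>f\<close> lies in the radical and
  vanishes.\<close>

lemma (in local_ring) idempotents_trivial:
  assumes "e \<in> idempotents R"
  shows "e = \<zero> \<or> e = \<one>"
proof -
  let ?J = "jacobson_radical R"
  interpret J: left_ideal ?J R
    by (rule left_ideal_jacobson_radical)
  have e: "e \<in> carrier R" "e \<otimes> e = e"
    using assms by (auto simp: idempotents_def)
  have rep: "x \<in> ?J +> x" if "x \<in> carrier R" for x
    using that J.zero_closed by (force simp: a_r_coset_def')
  show ?thesis
  proof (cases "?J +> e = ?J")
    case True
    then show ?thesis
      using rep[of e] e assms idempotent_in_jacobson_radical by auto
  next
    case False
    then have "?J +> e \<in> Units (R Quot ?J)"
      using e by (intro division_ring.nonzero_Units[OF division_ring_quot])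
        (auto simp: FactRing_def A_RCOSETS_def')
    then obtain b where b: "b \<in> carrier R" and
      eq: "rcoset_mult R ?J (?J +> e) (?J +> b) = ?J +> \<one>"
      by (auto simp: Units_def FactRing_def A_RCOSETS_def')
    \<comment> \<open>\<open>rcoset_mult\<close> is a union of cosets over products of
      representatives; the pair \<open>e\<close>, \<open>b\<close> contributes the coset of
      \<open>e b\<close>.\<close>
    have "e \<otimes> b \<in> ?J +> \<one>"
      unfolding eq[symmetric] rcoset_mult_def using rep e b by (intro UN_I[of e] UN_I[of b]) simp_all
    then obtain j where j: "j \<in> ?J" "e \<otimes> b = j \<oplus> \<one>"
      by (auto simp: a_r_coset_def')
    have jc: "j \<in> carrier R"
      using j J.a_subset by blast
    define f where "f = \<one> \<ominus> e"
    have f: "f \<in> carrier R" "f \<otimes> e = \<zero>" "e \<oplus> f = \<one>"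
      unfolding f_def using e by (simp, simp add: a_minus_def l_distr l_minus r_neg, algebra)
    have "f \<otimes> j \<oplus> f = f \<otimes> (e \<otimes> b)"
      unfolding j(2) using f jc by (simp add: r_distr)
    also have "\<dots> = \<zero>"
      using e f b by (simp add: m_assoc[symmetric])
    finally have "f = \<ominus> (f \<otimes> j)"
      using f jc by (metis add.inv_equality a_comm m_closed)
    then have fJ: "f \<in> ?J"
      using J.l_closed[OF j(1) f(1)] J.a_inv_closed by metis
    have "f \<otimes> f = f \<otimes> (e \<oplus> f)"
      using e f(1,2) by (simp add: r_distr)
    then have "f \<in> idempotents R"
      using f(1,3) by (simp add: idempotents_def)
    then have "f = \<zero>"
      using fJ by (rule idempotent_in_jacobson_radical)
    then have "e = \<one>"
      using f(3) e(1) by simp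
    then show ?thesis ..
  qed
qed

text \<open>By 2-primality the nilpotents form an intersection of ideals.\<close>

lemma (in two_primal_ring) ideal_nilpotents: "ideal (nilpotents R) R"
proof -
  \<comment> \<open>Inserting \<open>carrier R\<close> accounts for the intersection with the
    carrier and makes the family nonempty.\<close>
  have "prime_radical R = \<Inter>(insert (carrier R) {P. nc_primeideal P R})"
    by (auto simp: prime_radical_def)
  moreover have "ideal P R" if "P \<in> insert (carrier R) {P. nc_primeideal P R}" for P
    using that oneideal by (auto dest: nc_primeideal.axioms)
  ultimately show ?thesis
    using i_Intersect[of "insert (carrier R) {P. nc_primeideal P R}"] nilpotents_eq by auto
qed

section \<open>Matrix rings and matrices with entries in an ideal\<close>

definition matrices :: "nat \<Rightarrow> 'a set \<Rightarrow> (nat \<times> nat \<Rightarrow> 'a) set"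
  where "matrices n I = {..<n} \<times> {..<n} \<rightarrow>\<^sub>E I"

lemma matricesI:
  assumes "\<And>i j. i < n \<Longrightarrow> j < n \<Longrightarrow> A (i, j) \<in> I" and "A \<in> extensional ({..<n} \<times> {..<n})"
  shows "A \<in> matrices n I"
  using assms by (auto simp: matrices_def PiE_def)

lemma matricesD: "A \<in> matrices n I \<Longrightarrow> i < n \<Longrightarrow> j < n \<Longrightarrow> A (i, j) \<in> I"
  by (auto simp: matrices_def)

lemma matrices_mono: "I \<subseteq> J \<Longrightarrow> matrices n I \<subseteq> matrices n J"
  unfolding matrices_def by (rule PiE_mono) auto

lemma matrices_eqI:
  assumes "A \<in> matrices n I" "B \<in> matrices n J"
    and "\<And>i j. i < n \<Longrightarrow> j < n \<Longrightarrow> A (i, j) = B (i, j)"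
  shows "A = B"
  by (rule extensionalityI[of A "{..<n} \<times> {..<n}"]) (use assms in \<open>auto simp: matrices_def PiE_def\<close>)

lemma carrier_mat_ring: "carrier (mat_ring n R) = matrices n (carrier R)"
  by (simp add: mat_ring_def matrices_def)

lemma mat_ring_entries:
  assumes "i < n" "j < n"
  shows "(A \<otimes>\<^bsub>mat_ring n R\<^esub> B) (i, j) = (\<Oplus>\<^bsub>R\<^esub>k \<in> {..<n}. A (i, k) \<otimes>\<^bsub>R\<^esub> B (k, j))"
    and "(A \<oplus>\<^bsub>mat_ring n R\<^esub> B) (i, j) = A (i, j) \<oplus>\<^bsub>R\<^esub> B (i, j)"
    and "\<one>\<^bsub>mat_ring n R\<^esub> (i, j) = (if i = j then \<one>\<^bsub>R\<^esub> else \<zero>\<^bsub>R\<^esub>)"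
    and "\<zero>\<^bsub>mat_ring n R\<^esub> (i, j) = \<zero>\<^bsub>R\<^esub>"
  using assms by (auto simp: mat_ring_def)

lemma mat_ring_extensional:
  "A \<otimes>\<^bsub>mat_ring n R\<^esub> B \<in> extensional ({..<n} \<times> {..<n})"
  "A \<oplus>\<^bsub>mat_ring n R\<^esub> B \<in> extensional ({..<n} \<times> {..<n})"
  "\<one>\<^bsub>mat_ring n R\<^esub> \<in> extensional ({..<n} \<times> {..<n})"
  "\<zero>\<^bsub>mat_ring n R\<^esub> \<in> extensional ({..<n} \<times> {..<n})"
  by (auto simp: mat_ring_def extensional_def)

lemma (in abelian_monoid) finsum_swap:
  assumes "finite A" "finite B" "\<And>x y. x \<in> A \<Longrightarrow> y \<in> B \<Longrightarrow> f x y \<in> carrier G"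
  shows "(\<Oplus>x\<in>A. \<Oplus>y\<in>B. f x y) = (\<Oplus>y\<in>B. \<Oplus>x\<in>A. f x y)"
  using assms(1,3)
proof (induction A rule: finite_induct)
  case empty
  then show ?case
    by simp
next
  case (insert a A)
  have "(\<Oplus>y\<in>B. \<Oplus>x\<in>insert a A. f x y) = (\<Oplus>y\<in>B. f a y \<oplus> (\<Oplus>x\<in>A. f x y))"
    using insert by (intro finsum_cong') (auto simp: Pi_def intro!: finsum_insert finsum_closed)
  also have "\<dots> = (\<Oplus>y\<in>B. f a y) \<oplus> (\<Oplus>y\<in>B. \<Oplus>x\<in>A. f x y)"
    using insert by (intro finsum_addf) (auto simp: Pi_def intro!: finsum_closed)
  also have "(\<Oplus>y\<in>B. \<Oplus>x\<in>A. f x y) = (\<Oplus>x\<in>A. \<Oplus>y\<in>B. f x y)"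
    using insert by simp
  also have "(\<Oplus>y\<in>B. f a y) \<oplus> \<dots> = (\<Oplus>x\<in>insert a A. \<Oplus>y\<in>B. f x y)"
    using insert by (intro finsum_insert[symmetric]) (auto simp: Pi_def intro!: finsum_closed)
  finally show ?case ..
qed

lemma (in additive_subgroup) finsum_in_subgroup:
  assumes "abelian_monoid G" "finite A" "\<And>x. x \<in> A \<Longrightarrow> f x \<in> H"
  shows "finsum G f A \<in> H"
proof -
  interpret abelian_monoid G
    by (rule assms(1))
  show ?thesis
    using assms(2,3)
  proof (induction A rule: finite_induct)
    case (insert x A)
    then show ?case
      using a_subset by (subst finsum_insert) auto
  qed simp
qed

context ring
begin

lemma mat_ring_mult_closed:
  "A \<in> matrices n (carrier R) \<Longrightarrow> B \<in> matrices n (carrier R) \<Longrightarrow>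
    A \<otimes>\<^bsub>mat_ring n R\<^esub> B \<in> matrices n (carrier R)"
  by (intro matricesI) (auto simp: mat_ring_entries mat_ring_extensional Pi_def
      intro!: finsum_closed m_closed dest: matricesD)

text \<open>Distributing the outer factors turns both sides into the same double sum, up to the
  order of summation.\<close>

lemma mat_ring_mult_assoc:
  assumes A: "A \<in> matrices n (carrier R)" and B: "B \<in> matrices n (carrier R)"
    and C: "C \<in> matrices n (carrier R)"
  shows "A \<otimes>\<^bsub>mat_ring n R\<^esub> B \<otimes>\<^bsub>mat_ring n R\<^esub> C = A \<otimes>\<^bsub>mat_ring n R\<^esub> (B \<otimes>\<^bsub>mat_ring n R\<^esub> C)"
    (is "?L = ?R")
proof (rule matrices_eqI)
  show "?L \<in> matrices n (carrier R)" "?R \<in> matrices n (carrier R)"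
    using assms by (simp_all add: mat_ring_mult_closed)
  fix i j assume ij: "i < n" "j < n"
  note carr = matricesD[OF A] matricesD[OF B] matricesD[OF C]
  have "?L (i, j) = (\<Oplus>k\<in>{..<n}. (\<Oplus>l\<in>{..<n}. A (i, l) \<otimes> B (l, k)) \<otimes> C (k, j))"
    using ij carr unfolding mat_ring_entries(1)[OF ij]
    by (intro finsum_cong') (auto simp: mat_ring_entries Pi_def intro!: finsum_closed m_closed)
  also have "\<dots> = (\<Oplus>k\<in>{..<n}. \<Oplus>l\<in>{..<n}. A (i, l) \<otimes> B (l, k) \<otimes> C (k, j))"
    using ij carr by (intro finsum_cong' finsum_ldistr) (auto simp: Pi_def intro!: finsum_closed)
  also have "\<dots> = (\<Oplus>l\<in>{..<n}. \<Oplus>k\<in>{..<n}. A (i, l) \<otimes> B (l, k) \<otimes> C (k, j))"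
    using ij carr by (intro finsum_swap) auto
  also have "\<dots> = (\<Oplus>l\<in>{..<n}. \<Oplus>k\<in>{..<n}. A (i, l) \<otimes> (B (l, k) \<otimes> C (k, j)))"
    using ij carr by (intro finsum_cong') (auto simp: Pi_def m_assoc intro!: finsum_closed)
  also have "\<dots> = (\<Oplus>l\<in>{..<n}. A (i, l) \<otimes> (\<Oplus>k\<in>{..<n}. B (l, k) \<otimes> C (k, j)))"
    using ij carr by (intro finsum_cong' finsum_rdistr[symmetric]) (auto simp: Pi_def intro!: finsum_closed)
  also have "\<dots> = ?R (i, j)"
    using ij carr unfolding mat_ring_entries(1)[OF ij]
    by (intro finsum_cong') (auto simp: mat_ring_entries Pi_def intro!: finsum_closed m_closed)
  finally show "?L (i, j) = ?R (i, j)" .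
qed

lemma ring_mat_ring: "ring (mat_ring n R)"
proof (intro ringI abelian_groupI monoidI; unfold carrier_mat_ring)
  fix A B C
  assume A: "A \<in> matrices n (carrier R)" and B: "B \<in> matrices n (carrier R)"
    and C: "C \<in> matrices n (carrier R)"
  note carr = matricesD[OF A] matricesD[OF B] matricesD[OF C]
  show "A \<otimes>\<^bsub>mat_ring n R\<^esub> B \<otimes>\<^bsub>mat_ring n R\<^esub> C = A \<otimes>\<^bsub>mat_ring n R\<^esub> (B \<otimes>\<^bsub>mat_ring n R\<^esub> C)"
    by (rule mat_ring_mult_assoc[OF A B C])
  \<comment> \<open>With \<open>UNIV\<close> as the set of entries, membership in
    \<open>matrices\<close> amounts to extensionality, and the entrywise identity remains.\<close>
  show "A \<oplus>\<^bsub>mat_ring n R\<^esub> B \<oplus>\<^bsub>mat_ring n R\<^esub> C = A \<oplus>\<^bsub>mat_ring n R\<^esub> (B \<oplus>\<^bsub>mat_ring n R\<^esub> C)"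
    using carr by (intro matrices_eqI[of _ n UNIV _ UNIV] matricesI)
      (auto simp: mat_ring_entries mat_ring_extensional a_assoc)
  have distr: "(\<Oplus>k\<in>{..<n}. f k \<oplus> g k) = (\<Oplus>k\<in>{..<n}. f k) \<oplus> (\<Oplus>k\<in>{..<n}. g k)"
    if "\<And>k. k < n \<Longrightarrow> f k \<in> carrier R" "\<And>k. k < n \<Longrightarrow> g k \<in> carrier R" for f g
    using that by (intro finsum_addf) auto
  have "(\<Oplus>k\<in>{..<n}. (A \<oplus>\<^bsub>mat_ring n R\<^esub> B) (i, k) \<otimes> C (k, j))
      = (\<Oplus>k\<in>{..<n}. A (i, k) \<otimes> C (k, j) \<oplus> B (i, k) \<otimes> C (k, j))" if "i < n" "j < n" for i j
    using that carr by (intro finsum_cong') (auto simp: mat_ring_entries l_distr)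
  then show "(A \<oplus>\<^bsub>mat_ring n R\<^esub> B) \<otimes>\<^bsub>mat_ring n R\<^esub> C
      = A \<otimes>\<^bsub>mat_ring n R\<^esub> C \<oplus>\<^bsub>mat_ring n R\<^esub> B \<otimes>\<^bsub>mat_ring n R\<^esub> C"
    using carr by (intro matrices_eqI[of _ n UNIV _ UNIV] matricesI)
      (auto simp: mat_ring_entries(1,2) mat_ring_extensional distr)
  have "(\<Oplus>k\<in>{..<n}. C (i, k) \<otimes> (A \<oplus>\<^bsub>mat_ring n R\<^esub> B) (k, j))
      = (\<Oplus>k\<in>{..<n}. C (i, k) \<otimes> A (k, j) \<oplus> C (i, k) \<otimes> B (k, j))" if "i < n" "j < n" for i j
    using that carr by (intro finsum_cong') (auto simp: mat_ring_entries r_distr)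
  then show "C \<otimes>\<^bsub>mat_ring n R\<^esub> (A \<oplus>\<^bsub>mat_ring n R\<^esub> B)
      = C \<otimes>\<^bsub>mat_ring n R\<^esub> A \<oplus>\<^bsub>mat_ring n R\<^esub> C \<otimes>\<^bsub>mat_ring n R\<^esub> B"
    using carr by (intro matrices_eqI[of _ n UNIV _ UNIV] matricesI)
      (auto simp: mat_ring_entries(1,2) mat_ring_extensional distr)
next
  fix A B
  assume A: "A \<in> matrices n (carrier R)" and B: "B \<in> matrices n (carrier R)"
  note carr = matricesD[OF A] matricesD[OF B]
  show "A \<otimes>\<^bsub>mat_ring n R\<^esub> B \<in> matrices n (carrier R)"
    by (rule mat_ring_mult_closed[OF A B])
  show "A \<oplus>\<^bsub>mat_ring n R\<^esub> B \<in> matrices n (carrier R)"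
    using carr by (intro matricesI) (auto simp: mat_ring_entries mat_ring_extensional)
  show "A \<oplus>\<^bsub>mat_ring n R\<^esub> B = B \<oplus>\<^bsub>mat_ring n R\<^esub> A"
    using carr by (intro matrices_eqI[of _ n UNIV _ UNIV] matricesI)
      (auto simp: mat_ring_entries mat_ring_extensional a_comm)
next
  fix A
  assume A: "A \<in> matrices n (carrier R)"
  note carr = matricesD[OF A]
  have ext: "A \<in> extensional ({..<n} \<times> {..<n})"
    using A by (simp add: matrices_def PiE_def)
  show "\<zero>\<^bsub>mat_ring n R\<^esub> \<oplus>\<^bsub>mat_ring n R\<^esub> A = A"
    using carr ext by (intro matrices_eqI[of _ n UNIV _ UNIV] matricesI)
      (auto simp: mat_ring_entries mat_ring_extensional)
  have "(\<Oplus>k\<in>{..<n}. \<one>\<^bsub>mat_ring n R\<^esub> (i, k) \<otimes> A (k, j)) = A (i, j)" if "i < n" "j < n" for i j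
  proof -
    have "(\<Oplus>k\<in>{..<n}. \<one>\<^bsub>mat_ring n R\<^esub> (i, k) \<otimes> A (k, j))
        = (\<Oplus>k\<in>{..<n}. if i = k then A (k, j) else \<zero>)"
      using that carr by (intro finsum_cong') (auto simp: mat_ring_entries)
    also have "\<dots> = A (i, j)"
      using that carr by (intro finsum_singleton) auto
    finally show ?thesis .
  qed
  then show "\<one>\<^bsub>mat_ring n R\<^esub> \<otimes>\<^bsub>mat_ring n R\<^esub> A = A"
    using ext by (intro matrices_eqI[of _ n UNIV _ UNIV] matricesI)
      (auto simp: mat_ring_entries(1) mat_ring_extensional)
  have "(\<Oplus>k\<in>{..<n}. A (i, k) \<otimes> \<one>\<^bsub>mat_ring n R\<^esub> (k, j)) = A (i, j)" if "i < n" "j < n" for i j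
  proof -
    have "(\<Oplus>k\<in>{..<n}. A (i, k) \<otimes> \<one>\<^bsub>mat_ring n R\<^esub> (k, j))
        = (\<Oplus>k\<in>{..<n}. if j = k then A (i, k) else \<zero>)"
      using that carr by (intro finsum_cong') (auto simp: mat_ring_entries)
    also have "\<dots> = A (i, j)"
      using that carr by (intro finsum_singleton) auto
    finally show ?thesis .
  qed
  then show "A \<otimes>\<^bsub>mat_ring n R\<^esub> \<one>\<^bsub>mat_ring n R\<^esub> = A"
    using ext by (intro matrices_eqI[of _ n UNIV _ UNIV] matricesI)
      (auto simp: mat_ring_entries(1) mat_ring_extensional)
  show "\<exists>B \<in> matrices n (carrier R). B \<oplus>\<^bsub>mat_ring n R\<^esub> A = \<zero>\<^bsub>mat_ring n R\<^esub>"
  proof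
    define B where "B = (\<lambda>p \<in> {..<n} \<times> {..<n}. \<ominus> A p)"
    show "B \<in> matrices n (carrier R)"
      using carr by (intro matricesI) (auto simp: B_def)
    show "B \<oplus>\<^bsub>mat_ring n R\<^esub> A = \<zero>\<^bsub>mat_ring n R\<^esub>"
      using carr by (intro matrices_eqI[of _ n UNIV _ UNIV] matricesI)
        (auto simp: mat_ring_entries mat_ring_extensional B_def l_neg)
  qed
qed (auto intro!: matricesI simp: mat_ring_entries mat_ring_extensional)

text \<open>This transfers products of powers of a matrix to products of ideals, to which primeness
  refers.\<close>

lemma matrices_mult_ideal_prod:
  assumes I: "ideal I R" and J: "ideal J R" and A: "A \<in> matrices n I" and B: "B \<in> matrices n J"
  shows "A \<otimes>\<^bsub>mat_ring n R\<^esub> B \<in> matrices n (I \<cdot> J)"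
proof (rule matricesI)
  interpret IJ: ideal "I \<cdot> J" R
    by (rule ideal_prod_is_ideal[OF I J])
  fix i j assume "i < n" "j < n"
  then show "(A \<otimes>\<^bsub>mat_ring n R\<^esub> B) (i, j) \<in> I \<cdot> J"
    using matricesD[OF A] matricesD[OF B] abelian_monoid_axioms
    by (auto simp: mat_ring_entries intro!: IJ.finsum_in_subgroup ideal_prod.prod)
qed (rule mat_ring_extensional)

text \<open>An ideal \<open>P\<close> maximal with respect to the condition that no power of \<open>A\<close> has all its entries
  in \<open>P\<close> is prime: if powers of \<open>A\<close> have entries in \<open>I + P\<close> and in \<open>J + P\<close>, then their product has
  entries in \<open>I J + P\<close>.\<close>
lemma nilpotent_if_entries_in_prime_radical:
  assumes A: "A \<in> matrices n (prime_radical R)"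
  shows "A \<in> nilpotents (mat_ring n R)"
proof (rule ccontr)
  assume not_nil: "A \<notin> nilpotents (mat_ring n R)"
  interpret M: ring "mat_ring n R"
    by (rule ring_mat_ring)
  have Ac: "A \<in> carrier (mat_ring n R)"
    using A matrices_mono[of "prime_radical R" "carrier R" n]
    by (auto simp: carrier_mat_ring prime_radical_def)
  define S where "S = {I. ideal I R \<and> (\<forall>k::nat. A [^]\<^bsub>mat_ring n R\<^esub> k \<notin> matrices n I)}"
  \<comment> \<open>A matrix with entries in the zero ideal is the zero matrix, and no power of
    \<open>A\<close> is zero.\<close>
  have "{\<zero>} \<in> S"
  proof -
    have "X = \<zero>\<^bsub>mat_ring n R\<^esub>" if "X \<in> matrices n {\<zero>}" for X
      using that M.zero_closed unfolding carrier_mat_ring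
      by (rule matrices_eqI) (use matricesD[OF that] in \<open>auto simp: mat_ring_entries\<close>)
    then show ?thesis
      using not_nil Ac zeroideal by (auto simp: S_def nilpotents_def)
  qed
  have "\<exists>P\<in>S. \<forall>X\<in>S. P \<subseteq> X \<longrightarrow> X = P"
  proof (rule subset_Zorn_nonempty)
    fix \<C> assume ne: "\<C> \<noteq> {}" and ch: "subset.chain S \<C>"
    have "subset.chain {I. ideal I R} \<C>"
      using ch by (auto simp: subset.chain_def S_def)
    then have "ideal (\<Union>\<C>) R"
      using chain_Union_is_ideal[of \<C>] ne by simp
    moreover have "A [^]\<^bsub>mat_ring n R\<^esub> k \<notin> matrices n (\<Union>\<C>)" for k :: nat
    proof
      assume mem: "A [^]\<^bsub>mat_ring n R\<^esub> k \<in> matrices n (\<Union>\<C>)"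
      \<comment> \<open>The finitely many entries of the power already lie in one member of the
        chain.\<close>
      define E where "E = (A [^]\<^bsub>mat_ring n R\<^esub> k) ` ({..<n} \<times> {..<n})"
      have "finite E" "E \<subseteq> \<Union>\<C>"
        using matricesD[OF mem] by (auto simp: E_def)
      then obtain I where I: "I \<in> \<C>" "E \<subseteq> I"
        using finite_subset_Union_chain[OF _ _ ne ch] by metis
      have "A [^]\<^bsub>mat_ring n R\<^esub> k \<in> matrices n I"
        using mem I(2) by (auto simp: matrices_def E_def PiE_def)
      then show False
        using I(1) ch by (auto simp: subset.chain_def S_def)
    qed
    ultimately show "\<Union>\<C> \<in> S"
      by (simp add: S_def)
  qed (use \<open>{\<zero>} \<in> S\<close> in blast)
  then obtain P where P: "P \<in> S" and max: "\<And>X. X \<in> S \<Longrightarrow> P \<subseteq> X \<Longrightarrow> X = P"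
    by blast
  interpret P: ideal P R
    using P by (simp add: S_def)
  have no_pow: "A [^]\<^bsub>mat_ring n R\<^esub> k \<notin> matrices n P" for k :: nat
    using P by (simp add: S_def)
  \<comment> \<open>Otherwise \<open>I + P\<close> would belong to \<open>S\<close>, and maximality
    of \<open>P\<close> would force \<open>I\<close> into \<open>P\<close>.\<close>
  have pow_in: "\<exists>k::nat. A [^]\<^bsub>mat_ring n R\<^esub> k \<in> matrices n (I <+> P)"
    if I: "ideal I R" "\<not> I \<subseteq> P" for I
  proof (rule ccontr)
    assume "\<not> ?thesis"
    then have "I <+> P \<in> S"
      using add_ideals[OF I(1) P.is_ideal] by (auto simp: S_def)
    moreover have "P \<subseteq> I <+> P"
    proof
      fix x assume "x \<in> P"
      then have "x = \<zero> \<oplus> x"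
        by simp
      then show "x \<in> I <+> P"
        unfolding set_add_def'
        using \<open>x \<in> P\<close> additive_subgroup.zero_closed[OF ideal.axioms(1)[OF I(1)]] by blast
    qed
    moreover have "I \<subseteq> I <+> P"
    proof
      fix x assume "x \<in> I"
      then have "x = x \<oplus> \<zero>"
        by (simp add: ideal.Icarr[OF I(1)])
      then show "x \<in> I <+> P"
        unfolding set_add_def' using \<open>x \<in> I\<close> P.zero_closed by blast
    qed
    ultimately show False
      using max I(2) by blast
  qed
  have "nc_primeideal P R"
  proof (intro nc_primeideal.intro nc_primeideal_axioms.intro P.is_ideal)
    \<comment> \<open>The exponent \<open>0\<close> is what rules out \<open>P = R\<close>: the
      identity matrix has its entries in \<open>R\<close>.\<close>
    show "P \<noteq> carrier R"
      using no_pow[of 0] M.one_closed by (auto simp: carrier_mat_ring)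
    fix I J assume I: "ideal I R" and J: "ideal J R" and IJ: "I \<cdot> J \<subseteq> P"
    show "I \<subseteq> P \<or> J \<subseteq> P"
    proof (rule ccontr)
      assume "\<not> ?thesis"
      then obtain k l :: nat where "A [^]\<^bsub>mat_ring n R\<^esub> k \<in> matrices n (I <+> P)"
        "A [^]\<^bsub>mat_ring n R\<^esub> l \<in> matrices n (J <+> P)"
        using pow_in I J by metis
      then have "A [^]\<^bsub>mat_ring n R\<^esub> k \<otimes>\<^bsub>mat_ring n R\<^esub> A [^]\<^bsub>mat_ring n R\<^esub> l
          \<in> matrices n ((I <+> P) \<cdot> (J <+> P))"
        by (intro matrices_mult_ideal_prod add_ideals I J P.is_ideal)
      \<comment> \<open>On generators, \<open>(a + p) (b + q) = a b + a q + p (b + q)\<close>, where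
        \<open>a b\<close> is in \<open>I J\<close> and the other terms are in
        \<open>P\<close>.\<close>
      moreover have "(I <+> P) \<cdot> (J <+> P) \<subseteq> P"
      proof
        fix x assume "x \<in> (I <+> P) \<cdot> (J <+> P)"
        then show "x \<in> P"
        proof induction
          case (prod i j)
          then obtain a p b q where ab: "a \<in> I" "p \<in> P" "b \<in> J" "q \<in> P" "i = a \<oplus> p" "j = b \<oplus> q"
            by (auto simp: set_add_def')
          have carr: "a \<in> carrier R" "p \<in> carrier R" "b \<in> carrier R" "q \<in> carrier R"
            using ab ideal.Icarr[OF I] ideal.Icarr[OF J] P.Icarr by auto
          have "a \<otimes> b \<in> P"
            using ideal_prod.prod[OF ab(1,3)] IJ by (rule subsetD[rotated])
          then have "a \<otimes> b \<oplus> (a \<otimes> q \<oplus> p \<otimes> (b \<oplus> q)) \<in> P"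
            using ab(2,4) carr by (simp add: P.I_l_closed P.I_r_closed)
          moreover have "i \<otimes> j = a \<otimes> b \<oplus> (a \<otimes> q \<oplus> p \<otimes> (b \<oplus> q))"
            using carr by (simp add: ab l_distr r_distr a_ac)
          ultimately show ?case
            by simp
        qed simp
      qed
      ultimately show False
        using no_pow[of "k + l"] Ac by (auto simp: M.nat_pow_mult dest: matrices_mono)
    qed
  qed
  \<comment> \<open>As \<open>P\<close> is prime, already the first power of \<open>A\<close> has
    all its entries in \<open>P\<close>.\<close>
  then have "prime_radical R \<subseteq> P"
    by (auto simp: prime_radical_def)
  then have "A \<in> matrices n P"
    using A matrices_mono by blast
  then show False
    using no_pow[of 1] Ac by simp
qed

end

section \<open>The residue field with two elements and 2 x 2 matrices\<close>

locale local_strongly_nil_clean_two_primal_ring =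
  two_primal_ring + local_ring + strongly_nil_clean_ring
begin

lemma one_not_nilpotent: "\<one> \<notin> nilpotents R"
  using one_neq_zero by (simp add: nilpotents_def)

interpretation N: ideal "nilpotents R" R
  by (rule ideal_nilpotents)

text \<open>The idempotent in a strongly nil-clean decomposition is zero or one, and zero would make
  \<open>a\<close> nilpotent.\<close>

lemma nilpotent_or_one_plus_nilpotent:
  assumes "a \<in> carrier R" "a \<notin> nilpotents R"
  obtains q where "q \<in> nilpotents R" "a = \<one> \<oplus> q"
proof -
  obtain e q where e: "e \<in> idempotents R" and q: "q \<in> nilpotents R" and a: "a = e \<oplus> q"
    using all_strongly_nil_clean[OF assms(1)] by (auto simp: strongly_nil_clean_def)
  then have "e = \<one>"
    using idempotents_trivial[OF e] assms(2) by (auto simp: N.Icarr)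
  then show ?thesis
    using that q a by blast
qed

text \<open>This is the addition table of the field with two elements, where being nilpotent means
  being zero in the quotient.\<close>

lemma nilpotent_add_iff:
  assumes a: "a \<in> carrier R" and b: "b \<in> carrier R"
  shows "a \<oplus> b \<in> nilpotents R \<longleftrightarrow> (a \<in> nilpotents R \<longleftrightarrow> b \<in> nilpotents R)"
proof -
  have cancel: "x \<oplus> y \<in> nilpotents R \<longleftrightarrow> y \<in> nilpotents R"
    if "x \<in> nilpotents R" "y \<in> carrier R" for x y
  proof
    assume "x \<oplus> y \<in> nilpotents R"
    then have "\<ominus> x \<oplus> (x \<oplus> y) \<in> nilpotents R"
      using that N.a_inv_closed by blast
    then show "y \<in> nilpotents R"
      using that N.Icarr by (simp add: r_neg2 r_neg1)
  qed (use that in simp)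
  \<comment> \<open>The residue field has characteristic two: otherwise \<open>1 + 1 = 1 + q\<close>
    with \<open>q\<close> nilpotent, and one would be nilpotent.\<close>
  have two: "\<one> \<oplus> \<one> \<in> nilpotents R"
  proof (rule ccontr)
    assume "\<one> \<oplus> \<one> \<notin> nilpotents R"
    then obtain q where q: "q \<in> nilpotents R" "\<one> \<oplus> \<one> = \<one> \<oplus> q"
      using nilpotent_or_one_plus_nilpotent[of "\<one> \<oplus> \<one>"] by auto
    then have "\<one> = q"
      using N.Icarr by simp
    then show False
      using q one_not_nilpotent by simp
  qed
  consider "a \<in> nilpotents R" | "b \<in> nilpotents R" | "a \<notin> nilpotents R" "b \<notin> nilpotents R"
    by blast
  then show ?thesis
  proof cases
    case 1
    then show ?thesis
      using cancel b by simp
  next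
    case 2
    then show ?thesis
      using cancel[of b a] a b by (simp add: a_comm)
  next
    case 3
    obtain p where p: "p \<in> nilpotents R" "a = \<one> \<oplus> p"
      using nilpotent_or_one_plus_nilpotent a 3 by metis
    obtain q where q: "q \<in> nilpotents R" "b = \<one> \<oplus> q"
      using nilpotent_or_one_plus_nilpotent b 3 by metis
    have "a \<oplus> b = (\<one> \<oplus> \<one>) \<oplus> (p \<oplus> q)"
      using p q N.Icarr[OF p(1)] N.Icarr[OF q(1)] by (simp add: a_ac)
    then show ?thesis
      using 3 N.a_closed[OF two N.a_closed[OF p(1) q(1)]] by simp
  qed
qed

text \<open>A non-nilpotent \<open>a\<close> is \<open>1 + q\<close>, so
  \<open>a b = b + q b\<close> is congruent to \<open>b\<close> modulo the nilpotents.\<close>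

lemma nilpotent_mult_iff:
  assumes a: "a \<in> carrier R" and b: "b \<in> carrier R"
  shows "a \<otimes> b \<in> nilpotents R \<longleftrightarrow> a \<in> nilpotents R \<or> b \<in> nilpotents R"
proof (cases "a \<in> nilpotents R")
  case True
  then show ?thesis
    using N.I_r_closed b by simp
next
  case False
  then obtain q where q: "q \<in> nilpotents R" "a = \<one> \<oplus> q"
    using nilpotent_or_one_plus_nilpotent a by metis
  have "q \<otimes> b \<in> nilpotents R"
    using N.I_r_closed q(1) b by simp
  moreover have "a \<otimes> b = b \<oplus> q \<otimes> b"
    using q N.Icarr b by (simp add: l_distr)
  ultimately show ?thesis
    using False b N.Icarr by (simp add: nilpotent_add_iff)
qed

lemma nilpotent_mat:
  "A \<in> matrices n (nilpotents R) \<Longrightarrow> A \<in> nilpotents (mat_ring n R)"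
  using nilpotent_if_entries_in_prime_radical nilpotents_eq by simp

text \<open>Cayley--Hamilton over the field with two elements: with \<open>B = A\<close> if the trace vanishes and
  \<open>B = 1 - A\<close> otherwise, \<open>A B\<close> is congruent to the determinant.\<close>
lemma mat2_cayley_hamilton:
  fixes A
  defines "M \<equiv> mat_ring 2 R" and "K \<equiv> matrices 2 (nilpotents R)"
  assumes A: "A \<in> carrier M"
  shows "\<exists>B \<in> {A, \<one>\<^bsub>M\<^esub> \<ominus>\<^bsub>M\<^esub> A}. A \<otimes>\<^bsub>M\<^esub> B \<in> K \<or> \<one>\<^bsub>M\<^esub> \<ominus>\<^bsub>M\<^esub> A \<otimes>\<^bsub>M\<^esub> B \<in> K"
proof -
  interpret M: ring M
    unfolding M_def by (rule ring_mat_ring)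
  have carr: "X (i, j) \<in> carrier R" if "X \<in> carrier M" "i < 2" "j < 2" for X i j
    using that matricesD[of X 2 "carrier R" i j] by (simp add: M_def carrier_mat_ring)
  have lt2: "i < 2 \<longleftrightarrow> i = 0 \<or> i = 1" for i :: nat
    by auto
  have KI: "X \<in> K \<longleftrightarrow> X (0, 0) \<in> nilpotents R \<and> X (0, 1) \<in> nilpotents R \<and>
      X (1, 0) \<in> nilpotents R \<and> X (1, 1) \<in> nilpotents R" if "X \<in> carrier M" for X
  proof -
    have "X \<in> extensional ({..<2} \<times> {..<2})"
      using that by (simp add: M_def carrier_mat_ring matrices_def PiE_def)
    then show ?thesis
      unfolding K_def using matricesD[of X 2] by (auto simp: lt2 intro!: matricesI)
  qed
  \<comment> \<open>Nilpotency of an entry becomes a Boolean: a product vanishes in the residue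
    field iff a factor does, and a sum of two terms vanishes iff both or neither do.\<close>
  have mult: "(X \<otimes>\<^bsub>M\<^esub> Y) (i, j) \<in> nilpotents R \<longleftrightarrow>
     ((X (i, 0) \<in> nilpotents R \<or> Y (0, j) \<in> nilpotents R) \<longleftrightarrow>
      (X (i, 1) \<in> nilpotents R \<or> Y (1, j) \<in> nilpotents R))"
    if "X \<in> carrier M" "Y \<in> carrier M" "i < 2" "j < 2" for X Y i j
  proof -
    \<comment> \<open>The term for index \<open>1\<close> comes first because
      \<open>lessThan_Suc\<close> inserts the larger index first.\<close>
    have "(X \<otimes>\<^bsub>M\<^esub> Y) (i, j) = X (i, 1) \<otimes> Y (1, j) \<oplus> X (i, 0) \<otimes> Y (0, j)"
      using that carr[of X] carr[of Y]
      by (simp add: M_def mat_ring_entries numeral_2_eq_2 lessThan_Suc)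
    then show ?thesis
      using that carr[of X] carr[of Y] by (auto simp: nilpotent_add_iff nilpotent_mult_iff)
  qed
  have one_minus: "(\<one>\<^bsub>M\<^esub> \<ominus>\<^bsub>M\<^esub> X) (i, j) \<in> nilpotents R \<longleftrightarrow> (i = j \<longleftrightarrow> X (i, j) \<notin> nilpotents R)"
    if X: "X \<in> carrier M" and ij: "i < 2" "j < 2" for X i j
  proof -
    let ?Y = "\<one>\<^bsub>M\<^esub> \<ominus>\<^bsub>M\<^esub> X"
    have Y: "?Y \<in> carrier M"
      using X by simp
    have "?Y \<oplus>\<^bsub>M\<^esub> X = \<one>\<^bsub>M\<^esub>"
      using X by (simp add: M.minus_add_cancel)
    then have "(?Y \<oplus>\<^bsub>M\<^esub> X) (i, j) = \<one>\<^bsub>M\<^esub> (i, j)"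
      by simp
    then have "?Y (i, j) \<oplus> X (i, j) = (if i = j then \<one> else \<zero>)"
      using ij by (simp add: M_def mat_ring_entries)
    then show ?thesis
      using nilpotent_add_iff[OF carr[OF Y ij] carr[OF X ij]] one_not_nilpotent by (auto split: if_splits)
  qed
  have A': "\<one>\<^bsub>M\<^esub> \<ominus>\<^bsub>M\<^esub> A \<in> carrier M"
    using A by simp
  \<comment> \<open>What remains is propositional in the four statements that an entry of
    \<open>A\<close> is nilpotent: a check over all 2 x 2 matrices over the field with two
    elements.\<close>
  show ?thesis
    using A A' by (simp add: KI mult one_minus) blast
qed

theorem gsnc_mat2: "gsnc_ring (mat_ring 2 R)"
proof (intro gsnc_ring.intro gsnc_ring_axioms.intro ring_mat_ring)
  let ?M = "mat_ring 2 R"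
  interpret M: ring ?M
    by (rule ring_mat_ring)
  fix A assume A: "A \<in> carrier ?M" and nu: "A \<notin> Units ?M"
  define B' where "B' = \<one>\<^bsub>?M\<^esub> \<ominus>\<^bsub>?M\<^esub> A"
  have B': "B' \<in> carrier ?M" "A \<oplus>\<^bsub>?M\<^esub> B' = \<one>\<^bsub>?M\<^esub>"
    using A by (simp_all add: B'_def M.add_minus_cancel)
  obtain B where B: "B \<in> {A, B'}"
    and K: "A \<otimes>\<^bsub>?M\<^esub> B \<in> nilpotents ?M \<or> \<one>\<^bsub>?M\<^esub> \<ominus>\<^bsub>?M\<^esub> A \<otimes>\<^bsub>?M\<^esub> B \<in> nilpotents ?M"
    using mat2_cayley_hamilton[OF A] nilpotent_mat unfolding B'_def by blast
  have Bc: "B \<in> carrier ?M" "A \<otimes>\<^bsub>?M\<^esub> B = B \<otimes>\<^bsub>?M\<^esub> A"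
    using B A B' M.commute_if_add_eq_one[OF A B'] by auto
  \<comment> \<open>Otherwise \<open>A B\<close> is one minus a nilpotent matrix, hence a unit; as
    \<open>B\<close> commutes with \<open>A\<close>, so is \<open>A\<close>, against
    \<open>nu\<close>.\<close>
  have "A \<otimes>\<^bsub>?M\<^esub> B \<in> nilpotents ?M"
  proof (rule ccontr)
    assume "\<not> ?thesis"
    then have "\<one>\<^bsub>?M\<^esub> \<ominus>\<^bsub>?M\<^esub> A \<otimes>\<^bsub>?M\<^esub> B \<in> nilpotents ?M"
      using K by blast
    then have "A \<otimes>\<^bsub>?M\<^esub> B \<in> Units ?M"
      by (rule M.Units_if_one_minus_nilpotent) (use A Bc in \<open>simp_all add: M.minus_add_cancel\<close>)
    then show False
      using M.Units_if_commuting_mult_Units[OF A Bc] nu by blast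
  qed
  \<comment> \<open>For \<open>B = A\<close> the square of \<open>A\<close> is nilpotent, hence so
    is \<open>A\<close>; for \<open>B = 1 - A\<close> the idempotent is lifted.\<close>
  then show "strongly_nil_clean ?M A"
    using B M.strongly_nil_clean_if_nilpotent_mult_one_minus[OF A B']
      M.strongly_nil_clean_if_nilpotent M.nilpotents_if_square_nilpotent[OF A] by auto
qed

end

theorem theorem4p12:
  fixes R :: "('a, 'm) ring_scheme" (structure)
  assumes "two_primal_ring R" and "local_ring R" and "strongly_nil_clean_ring R"
  shows "gsnc_ring (mat_ring 2 R)"
  using assms
  by (intro local_strongly_nil_clean_two_primal_ring.gsnc_mat2
      local_strongly_nil_clean_two_primal_ring.intro)

end
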